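(* For $n=o(2^T)$, any deterministic algorithm that achieves regret $R$ for the discrete prediction with experts problem with $n$ experts and $T$ days must use $\Omega\left(\frac{nM}{RT}\right)$ space when the best expert makes $M$ mistakes.
   Context: Discrete prediction with experts problem (streaming). There are $n$ experts and $T$ days. On each day $t\in[T]$, the algorithm first receives the predictions of all $n$ experts (elements of a fixed finite set, e.g. $\{0,1\}$), then outputs its own prediction for that day, and then the correct outcome of day $t$ is revealed. A prediction (by an expert or by the algorithm) costs $0$ if it equals the outcome and $1$ otherwise (a mistake). The number of mistakes of the best expert is the minimum over experts of the total number of mistakes made over the $T$ days; it is denoted $M$. Regret is amortized over days: the algorithm achieves regret $R$ if its total number of mistakes exceeds that of the best expert by at most $RT$. The space of the algorithm is the number of bits of memory it keeps while processing the stream of days. A deterministic algorithm must achieve the regret guarantee on every input stream.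
   Formalization: The formal theorem requires at least two experts and regret 0 < R ≤ ρ for a fixed ρ < 1, with the Ω-constant depending on ρ; for R = 1 (M = T) a memoryless algorithm refutes the bound, and for n = 1 following the only expert needs no memory. *)

theory Defs
  imports Complex_Main "HOL-Library.Landau_Symbols"
begin

text \<open>
  A day is a pair of the list of the experts' predictions (entry \<open>i\<close> belongs to expert \<open>i\<close>)
  and the outcome. Predictions and outcomes range over a type \<open>'a\<close>, which is finite and has at
  least two elements in the theorem.
\<close>

type_synonym 'a day = "'a list \<times> 'a"

definition day_streams :: "nat \<Rightarrow> nat \<Rightarrow> 'a day list set" where
  "day_streams n T = {xs. length xs = T \<and> (\<forall>d \<in> set xs. length (fst d) = n)}"

definition expert_mistakes :: "'a day list \<Rightarrow> nat \<Rightarrow> nat" where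
  "expert_mistakes xs i = card {t. t < length xs \<and> fst (xs ! t) ! i \<noteq> snd (xs ! t)}"

definition best_mistakes :: "nat \<Rightarrow> 'a day list \<Rightarrow> nat" where
  "best_mistakes n xs = Min (expert_mistakes xs ` {..<n})"

definition instances :: "nat \<Rightarrow> nat \<Rightarrow> nat \<Rightarrow> 'a day list set" where
  "instances n T M = {xs \<in> day_streams n T. best_mistakes n xs \<le> M}"

text \<open>
  A deterministic streaming algorithm keeps a bit string from one day to the next. The prediction
  depends on that string and on the experts' predictions of the day; once the outcome is
  revealed, a new string is stored. The algorithm's own prediction need not be an argument of
  \<open>next_mem\<close>, since it is determined by the other arguments. Only the memory carried between days
  is charged, and it may vary in length; there is no free access to the day number. Computation
  within a day is unrestricted, which only makes a space lower bound stronger.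
\<close>

record 'a expert_alg =
  init_mem :: "bool list"
  predict :: "bool list \<Rightarrow> 'a list \<Rightarrow> 'a"
  next_mem :: "bool list \<Rightarrow> 'a list \<Rightarrow> 'a \<Rightarrow> bool list"

definition memory :: "'a expert_alg \<Rightarrow> 'a day list \<Rightarrow> bool list" where
  "memory A xs = foldl (\<lambda>m (ps, y). next_mem A m ps y) (init_mem A) xs"

definition alg_mistakes :: "'a expert_alg \<Rightarrow> 'a day list \<Rightarrow> nat" where
  "alg_mistakes A xs =
     card {t. t < length xs \<and> predict A (memory A (take t xs)) (fst (xs ! t)) \<noteq> snd (xs ! t)}"

text \<open>
  Both the guarantee and the space refer to the streams whose best expert makes at most \<open>M\<close>
  mistakes. For \<open>M \<ge> T\<close> these are all streams; a guarantee on all streams implies the one for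
  every \<open>M\<close>. A guarantee on all streams would force \<open>R \<ge> 1 / 2\<close> as soon as there are two
  experts (take two experts who always disagree, and let the outcome always contradict the
  algorithm).
\<close>

definition achieves_regret :: "'a expert_alg \<Rightarrow> nat \<Rightarrow> nat \<Rightarrow> nat \<Rightarrow> real \<Rightarrow> bool" where
  "achieves_regret A n T M R \<longleftrightarrow>
     (\<forall>xs \<in> instances n T M.
        real (alg_mistakes A xs) \<le> real (best_mistakes n xs) + R * real T)"

text \<open>
  The maximum is over a finite nonempty set when \<open>'a\<close> is finite and \<open>n > 0\<close>.
\<close>

definition alg_space :: "'a expert_alg \<Rightarrow> nat \<Rightarrow> nat \<Rightarrow> nat \<Rightarrow> nat" where
  "alg_space A n T M =
     Max {length (memory A (take t xs)) | xs t. xs \<in> instances n T M \<and> t \<le> T}"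

end

theory Submission
  imports Defs "HOL-Library.FuncSet"
begin

text \<open>
  Fix a memory state and let the outcome always contradict the algorithm. The \<open>2 ^ n\<close> vectors of
  binary predictions lead to fewer than \<open>2 ^ (S + 1)\<close> states, so many of them lead to one state
  \<open>m'\<close>. A vector is determined by its outcome and its set of correct experts; hence the sets of
  correct experts for the vectors leading to \<open>m'\<close> have a union that misses at most \<open>S + 1\<close>
  experts. So there is a path of states along which the algorithm errs every day and which, on
  each day, can be realised with any given expert correct, apart from \<open>S + 1\<close> exceptions. By
  averaging over the experts, some expert is exceptional on at most \<open>N (S + 1) / n\<close> of the first
  \<open>N\<close> days, and \<open>N\<close> can be taken about \<open>n M / (S + 1)\<close> as long as this is at most \<open>T\<close>. The
  remaining parameter ranges follow from \<open>R T \<ge> M / 2\<close>, which two always disagreeing experts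
  enforce.
\<close>

section \<open>Memory and mistake counts after one more day\<close>

lemma card_less_snoc:
  "card {t. t < Suc k \<and> P t} = card {t. t < k \<and> P t} + (if P k then 1 else 0)"
proof -
  have "{t. t < Suc k \<and> P t} = {t. t < k \<and> P t} \<union> (if P k then {k} else {})"
    by (auto simp: less_Suc_eq)
  then show ?thesis by auto
qed

lemma memory_Nil [simp]: "memory A [] = init_mem A"
  by (simp add: memory_def)

lemma memory_snoc [simp]:
  "memory A (xs @ [d]) = next_mem A (memory A xs) (fst d) (snd d)"
  by (simp add: memory_def case_prod_beta)

lemma alg_mistakes_Nil [simp]: "alg_mistakes A [] = 0"
  by (simp add: alg_mistakes_def)

lemma alg_mistakes_snoc [simp]:
  "alg_mistakes A (xs @ [d]) =
     alg_mistakes A xs + (if predict A (memory A xs) (fst d) \<noteq> snd d then 1 else 0)"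
proof -
  have "{t. t < length xs \<and> predict A (memory A (take t (xs @ [d]))) (fst ((xs @ [d]) ! t))
            \<noteq> snd ((xs @ [d]) ! t)}
      = {t. t < length xs \<and> predict A (memory A (take t xs)) (fst (xs ! t)) \<noteq> snd (xs ! t)}"
    by (auto simp: nth_append)
  then show ?thesis
    unfolding alg_mistakes_def length_append_singleton card_less_snoc by simp
qed

lemma expert_mistakes_Nil [simp]: "expert_mistakes [] i = 0"
  by (simp add: expert_mistakes_def)

lemma expert_mistakes_snoc [simp]:
  "expert_mistakes (xs @ [d]) i = expert_mistakes xs i + (if fst d ! i \<noteq> snd d then 1 else 0)"
proof -
  have "{t. t < length xs \<and> fst ((xs @ [d]) ! t) ! i \<noteq> snd ((xs @ [d]) ! t)}
      = {t. t < length xs \<and> fst (xs ! t) ! i \<noteq> snd (xs ! t)}"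
    by (auto simp: nth_append)
  then show ?thesis
    unfolding expert_mistakes_def length_append_singleton card_less_snoc by simp
qed

lemma day_streams_0 [simp]: "day_streams n 0 = {[]}"
  by (auto simp: day_streams_def)

lemma day_streams_snoc:
  "xs \<in> day_streams n t \<Longrightarrow> length (fst d) = n \<Longrightarrow> xs @ [d] \<in> day_streams n (Suc t)"
  by (auto simp: day_streams_def)

lemma finite_day_streams: "finite (day_streams n T :: ('a::finite) day list set)"
proof -
  let ?D = "{ps :: 'a list. set ps \<subseteq> UNIV \<and> length ps = n} \<times> (UNIV :: 'a set)"
  have "finite ?D" by (intro finite_cartesian_product finite_lists_length_eq) auto
  then have "finite {xs. set xs \<subseteq> ?D \<and> length xs = T}" by (rule finite_lists_length_eq)
  moreover have "day_streams n T \<subseteq> {xs. set xs \<subseteq> ?D \<and> length xs = T}"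
    by (auto simp: day_streams_def)
  ultimately show ?thesis by (rule rev_finite_subset)
qed

section \<open>Passing from prefixes to streams of full length\<close>

lemma alg_mistakes_append_mono: "alg_mistakes A xs \<le> alg_mistakes A (xs @ ys)"
proof (induction ys rule: rev_induct)
  case (snoc y ys)
  then show ?case unfolding append_assoc[symmetric] alg_mistakes_snoc by simp
qed simp

lemma best_mistakes_le: "i < n \<Longrightarrow> best_mistakes n xs \<le> expert_mistakes xs i"
  by (simp add: best_mistakes_def)

text \<open>Days on which all experts agree with the outcome cost no expert anything. Such padding
  turns a prefix into a stream of length \<open>T\<close>, the only kind that the guarantee and the
  space refer to.\<close>

lemma extend_stream:
  assumes "xs \<in> day_streams n t" "t \<le> T"
  obtains zs where "xs @ zs \<in> day_streams n T"
    "\<And>i. i < n \<Longrightarrow> expert_mistakes (xs @ zs) i = expert_mistakes xs i"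
proof -
  have "\<exists>zs. xs @ zs \<in> day_streams n (t + k) \<and>
          (\<forall>i<n. expert_mistakes (xs @ zs) i = expert_mistakes xs i)" for k
  proof (induction k)
    case 0
    then show ?case using assms by (intro exI[of _ "[]"]) auto
  next
    case (Suc k)
    then obtain zs where zs: "xs @ zs \<in> day_streams n (t + k)"
      "\<forall>i<n. expert_mistakes (xs @ zs) i = expert_mistakes xs i" by blast
    \<comment> \<open>Any value would do in place of \<open>undefined\<close>: only the agreement of
      predictions and outcome matters.\<close>
    let ?d = "(replicate n undefined, undefined)"
    have "(xs @ zs) @ [?d] \<in> day_streams n (t + Suc k)"
      using day_streams_snoc[OF zs(1), of ?d] by simp
    moreover have "\<forall>i<n. expert_mistakes ((xs @ zs) @ [?d]) i = expert_mistakes xs i"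
      using zs(2) unfolding expert_mistakes_snoc by simp
    ultimately show ?case unfolding append_assoc by blast
  qed
  from this[of "T - t"] show ?thesis using assms(2) that by auto
qed

lemma prefix_memory_le_space:
  fixes A :: "'a::finite expert_alg"
  assumes xs: "xs \<in> day_streams n t" and "t \<le> T" and "i < n" and "expert_mistakes xs i \<le> M"
  shows "length (memory A xs) \<le> alg_space A n T M"
proof -
  obtain zs where zs: "xs @ zs \<in> day_streams n T"
    "expert_mistakes (xs @ zs) i = expert_mistakes xs i"
    using extend_stream[OF xs \<open>t \<le> T\<close>] \<open>i < n\<close> by metis
  then have inst: "xs @ zs \<in> instances n T M"
    using best_mistakes_le[OF \<open>i < n\<close>, of "xs @ zs"] assms(4) by (simp add: instances_def)
  have t: "length xs = t" using xs by (simp add: day_streams_def)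
  let ?L = "{length (memory A (take t ys)) | ys t. ys \<in> instances n T M \<and> t \<le> T}"
  have "?L = (\<lambda>(ys, t). length (memory A (take t ys))) ` (instances n T M \<times> {..T})"
    by auto
  moreover have "finite (instances n T M :: 'a day list set)"
    by (simp add: instances_def finite_day_streams)
  ultimately have "finite ?L" by simp
  moreover have "length (memory A xs) \<in> ?L"
    using inst \<open>t \<le> T\<close> t by (auto intro!: exI[of _ "xs @ zs"] exI[of _ t])
  ultimately show ?thesis unfolding alg_space_def by (rule Max_ge)
qed

text \<open>Padding leaves the mistakes of the experts unchanged and cannot lower those of the
  algorithm, so the guarantee applies on any day, though with the full allowance
  \<open>R * T\<close>.\<close>

lemma mistakes_le_regret:
  assumes ach: "achieves_regret A n T M R" and xs: "xs \<in> day_streams n t" and "t \<le> T"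
    and "i < n" and "expert_mistakes xs i \<le> M"
  shows "real (alg_mistakes A xs) \<le> real (expert_mistakes xs i) + R * real T"
proof -
  obtain zs where zs: "xs @ zs \<in> day_streams n T"
    "expert_mistakes (xs @ zs) i = expert_mistakes xs i"
    using extend_stream[OF xs \<open>t \<le> T\<close>] \<open>i < n\<close> by metis
  have b: "best_mistakes n (xs @ zs) \<le> expert_mistakes xs i"
    using best_mistakes_le[OF \<open>i < n\<close>, of "xs @ zs"] zs(2) by simp
  with zs(1) assms(5) have "xs @ zs \<in> instances n T M" by (simp add: instances_def)
  with ach have "real (alg_mistakes A (xs @ zs)) \<le> real (best_mistakes n (xs @ zs)) + R * real T"
    by (simp add: achieves_regret_def)
  with b alg_mistakes_append_mono[of A xs zs] show ?thesis by linarith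
qed

section \<open>One day that contradicts the algorithm\<close>

lemma card_bool_lists_le: "card {l :: bool list. length l \<le> S} < 2 ^ Suc S"
proof -
  have "card {l :: bool list. set l \<subseteq> UNIV \<and> length l \<le> S} = (\<Sum>i\<le>S. 2 ^ i)"
    by (subst card_lists_length_le) auto
  also have "\<dots> < (2::nat) ^ Suc S"
    by (induction S) auto
  finally show ?thesis by simp
qed

text \<open>The order of quantifiers is the point: \<open>m'\<close> and \<open>B\<close> are common
  to all experts, and only the day leading to \<open>m'\<close> depends on \<open>i\<close>. This
  lets the steps be chained.\<close>

lemma contradicting_step:
  fixes A :: "'a expert_alg" and x y :: 'a
  assumes "x \<noteq> y"
    and short: "\<And>ps z. length ps = n \<Longrightarrow> length (next_mem A m ps z) \<le> S"
  obtains m' B where "B \<subseteq> {..<n}" "card B \<le> Suc S"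
    "\<And>i. i < n \<Longrightarrow> \<exists>ps z. length ps = n \<and> predict A m ps \<noteq> z \<and> next_mem A m ps z = m'
                          \<and> (i \<notin> B \<longrightarrow> ps ! i = z)"
proof -
  define D where "D = {ps. set ps \<subseteq> {x, y} \<and> length ps = n}"
  \<comment> \<open>Also when the prediction is neither \<open>x\<close> nor \<open>y\<close>, this
    outcome contradicts it.\<close>
  define out where "out ps = (if predict A m ps = x then y else x)" for ps
  define g where "g ps = next_mem A m ps (out ps)" for ps
  define good where "good ps = {i. i < n \<and> ps ! i = out ps}" for ps
  let ?L = "{l :: bool list. length l \<le> S}"
  have finL: "finite ?L"
    using finite_lists_length_le[of "UNIV :: bool set" S] by simp
  have cardD: "card D = 2 ^ n"
    unfolding D_def using \<open>x \<noteq> y\<close> by (subst card_lists_length_eq) (auto simp: numeral_2_eq_2)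
  have finD: "finite D" unfolding D_def by (rule finite_lists_length_eq) simp
  have "\<exists>m'\<in>?L. card D \<le> card (g -` {m'} \<inter> D) * card ?L"
  proof (rule pigeonhole_card)
    show "g \<in> D \<rightarrow> ?L" using short by (auto simp: D_def g_def)
    show "?L \<noteq> {}" by (auto intro: exI[of _ "[]"])
  qed (use finD finL in auto)
  then obtain m' where m': "card D \<le> card (g -` {m'} \<inter> D) * card ?L" by blast
  define F where "F = g -` {m'} \<inter> D"
  define W where "W = (\<Union>ps\<in>F. good ps)"
  have W: "W \<subseteq> {..<n}" by (auto simp: W_def good_def)
  then have finW: "finite W" by (rule finite_subset) simp
  \<comment> \<open>Given the outcome, a correct expert predicted it and any other predicted the
    other one of \<open>x\<close> and \<open>y\<close>, so the vector can be recovered.\<close>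
  have "inj_on (\<lambda>ps. (good ps, out ps)) D"
  proof (rule inj_onI)
    fix ps qs assume *: "ps \<in> D" "qs \<in> D" "(good ps, out ps) = (good qs, out qs)"
    show "ps = qs"
    proof (rule nth_equalityI)
      show "length ps = length qs" using * by (simp add: D_def)
      fix i assume i: "i < length ps"
      have "i < n" "ps ! i \<in> set ps" "qs ! i \<in> set qs" using * i by (auto simp: D_def)
      then have "i < n" "ps ! i \<in> {x, y}" "qs ! i \<in> {x, y}"
        using * unfolding D_def by blast+
      moreover have "ps ! i = out qs \<longleftrightarrow> qs ! i = out qs"
      proof -
        have "i \<in> good ps \<longleftrightarrow> i \<in> good qs" "out ps = out qs" using * by simp_all
        with \<open>i < n\<close> show ?thesis by (simp add: good_def)
      qed
      moreover have "out qs \<in> {x, y}" by (simp add: out_def)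
      ultimately show "ps ! i = qs ! i" by (metis insertE singletonD)
    qed
  qed
  then have "inj_on (\<lambda>ps. (good ps, out ps)) F"
    by (rule inj_on_subset) (simp add: F_def)
  moreover have "(\<lambda>ps. (good ps, out ps)) ` F \<subseteq> Pow W \<times> {x, y}"
    by (auto simp: W_def out_def)
  ultimately have "card F \<le> card (Pow W \<times> {x, y})"
    using finW by (intro card_inj_on_le) auto
  also have "\<dots> = 2 ^ Suc (card W)"
    using \<open>x \<noteq> y\<close> finW by (simp add: card_cartesian_product card_Pow)
  finally have cardF: "card F \<le> 2 ^ Suc (card W)" .
  \<comment> \<open>The strict bound on the number of states matters here: it yields
    \<open>Suc S\<close> exceptions instead of \<open>S + 2\<close>.\<close>
  have "2 ^ n \<le> card F * card ?L" using m' cardD by (simp add: F_def)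
  also have "\<dots> \<le> 2 ^ Suc (card W) * card ?L" using cardF by (rule mult_right_mono) simp
  also have "\<dots> < 2 ^ Suc (card W) * 2 ^ Suc S" using card_bool_lists_le by simp
  also have "\<dots> = 2 ^ (Suc (card W) + Suc S)" by (simp add: power_add)
  finally have "n < Suc (card W) + Suc S" by (rule power_less_imp_less_exp[rotated]) simp
  then have "card ({..<n} - W) \<le> Suc S"
    using card_Diff_subset[OF finW W] by simp
  \<comment> \<open>Exceptional experts need a day leading to \<open>m'\<close> too; any member of
    \<open>F\<close> serves them.\<close>
  have "F \<noteq> {}" using m' cardD by (auto simp: F_def)
  have day: "length ps = n \<and> predict A m ps \<noteq> out ps \<and> next_mem A m ps (out ps) = m'"
    if "ps \<in> F" for ps
    using that \<open>x \<noteq> y\<close> by (auto simp: F_def D_def g_def out_def)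
  show ?thesis
  proof (rule that)
    show "card ({..<n} - W) \<le> Suc S" by fact
    fix i assume "i < n"
    show "\<exists>ps z. length ps = n \<and> predict A m ps \<noteq> z \<and> next_mem A m ps z = m'
            \<and> (i \<notin> {..<n} - W \<longrightarrow> ps ! i = z)"
    proof (cases "i \<in> W")
      case True
      then obtain ps where "ps \<in> F" "ps ! i = out ps" by (auto simp: W_def good_def)
      with day show ?thesis by blast
    next
      case False
      with \<open>i < n\<close> \<open>F \<noteq> {}\<close> day show ?thesis by blast
    qed
  qed auto
qed

section \<open>Paths of memory states and the regret they force\<close>

text \<open>All experts share the state \<open>m\<close>, but each has its own stream reaching it;
  \<open>e i\<close> bounds the mistakes of expert \<open>i\<close> on that stream. Each step raises
  the total of these budgets by at most \<open>Suc S\<close>.\<close>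

lemma contradicting_path:
  fixes A :: "'a::finite expert_alg" and x y :: 'a
  assumes "x \<noteq> y" "N \<le> T" "N * Suc (alg_space A n T M) \<le> M * n" "t \<le> N"
  shows "\<exists>m e. (\<forall>i<n. \<exists>xs\<in>day_streams n t. memory A xs = m \<and> alg_mistakes A xs = t
                   \<and> expert_mistakes xs i \<le> e i)
           \<and> (\<Sum>i<n. e i) \<le> t * Suc (alg_space A n T M)"
  using \<open>t \<le> N\<close>
proof (induction t)
  case 0
  show ?case by (intro exI[of _ "init_mem A"] exI[of _ "\<lambda>_. 0"]) auto
next
  case (Suc t)
  define S where "S = alg_space A n T M"
  obtain m e where path: "\<And>i. i < n \<Longrightarrow> \<exists>xs\<in>day_streams n t. memory A xs = m
      \<and> alg_mistakes A xs = t \<and> expert_mistakes xs i \<le> e i"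
    and e: "(\<Sum>i<n. e i) \<le> t * Suc S"
    using Suc unfolding S_def by fastforce
  have "t * Suc S < N * Suc S" using Suc.prems by (intro mult_less_mono1) auto
  with e assms(3) have "(\<Sum>i<n. e i) < M * n" by (simp add: S_def)
  \<comment> \<open>An expert with a mistake to spare is required, because space is measured only on
    streams with at most \<open>M\<close> mistakes of the best expert. The stream of this expert
    reaches \<open>m\<close> and may be followed by any day at all, so every successor of
    \<open>m\<close> has length at most \<open>S\<close>.\<close>
  have "\<exists>i<n. e i < M"
  proof (rule ccontr)
    assume "\<not> ?thesis"
    then have "(\<Sum>i<n. M) \<le> (\<Sum>i<n. e i)" by (intro sum_mono) (metis lessThan_iff not_less)
    with \<open>(\<Sum>i<n. e i) < M * n\<close> show False by (simp add: mult.commute)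
  qed
  then obtain j where j: "j < n" "e j < M" by blast
  then obtain ys where ys: "ys \<in> day_streams n t" "memory A ys = m" "expert_mistakes ys j < M"
    using path by (meson le_less_trans)
  have short: "length (next_mem A m ps z) \<le> S" if "length ps = n" for ps z
  proof -
    have "length (memory A (ys @ [(ps, z)])) \<le> alg_space A n T M"
    proof (rule prefix_memory_le_space)
      show "ys @ [(ps, z)] \<in> day_streams n (Suc t)"
        using ys(1) that by (intro day_streams_snoc) auto
      show "Suc t \<le> T" using Suc.prems \<open>N \<le> T\<close> by simp
      show "j < n" by fact
      show "expert_mistakes (ys @ [(ps, z)]) j \<le> M" using ys(3) by simp
    qed
    with ys(2) show ?thesis by (simp add: S_def)
  qed
  obtain m' B where B: "B \<subseteq> {..<n}" "card B \<le> Suc S"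
    and step: "\<And>i. i < n \<Longrightarrow> \<exists>ps z. length ps = n \<and> predict A m ps \<noteq> z
        \<and> next_mem A m ps z = m' \<and> (i \<notin> B \<longrightarrow> ps ! i = z)"
    using contradicting_step[OF \<open>x \<noteq> y\<close> short] by metis
  define e' where "e' i = e i + (if i \<in> B then 1 else 0)" for i
  have "\<exists>xs\<in>day_streams n (Suc t). memory A xs = m' \<and> alg_mistakes A xs = Suc t
          \<and> expert_mistakes xs i \<le> e' i" if "i < n" for i
  proof -
    obtain xs where xs: "xs \<in> day_streams n t" "memory A xs = m" "alg_mistakes A xs = t"
      "expert_mistakes xs i \<le> e i" using path[OF \<open>i < n\<close>] by blast
    obtain ps z where d: "length ps = n" "predict A m ps \<noteq> z" "next_mem A m ps z = m'"
      "i \<notin> B \<longrightarrow> ps ! i = z" using step[OF \<open>i < n\<close>] by blast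
    show ?thesis
      using xs d by (intro bexI[of _ "xs @ [(ps, z)]"] day_streams_snoc) (auto simp: e'_def)
  qed
  moreover have "(\<Sum>i<n. e' i) \<le> Suc t * Suc S"
  proof -
    have "(\<Sum>i<n. if i \<in> B then 1 else 0) = card B"
      using B(1) by (simp add: sum.If_cases Int_absorb1 flip: lessThan_def)
    then show ?thesis using e B(2) by (simp add: e'_def sum.distrib)
  qed
  ultimately show ?case unfolding S_def by blast
qed

lemma path_regret:
  fixes A :: "'a::finite expert_alg" and x y :: 'a
  assumes "x \<noteq> y" and ach: "achieves_regret A n T M R" and "n > 0"
    and "N \<le> T" and N: "N * Suc (alg_space A n T M) \<le> M * n"
  shows "real N \<le> real N * real (Suc (alg_space A n T M)) / real n + R * real T"
proof -
  define S where "S = alg_space A n T M"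
  obtain m e where path: "\<And>i. i < n \<Longrightarrow> \<exists>xs\<in>day_streams n N. memory A xs = m
      \<and> alg_mistakes A xs = N \<and> expert_mistakes xs i \<le> e i"
    and e: "(\<Sum>i<n. e i) \<le> N * Suc S"
    using contradicting_path[OF \<open>x \<noteq> y\<close> \<open>N \<le> T\<close> N order.refl] unfolding S_def by blast
  \<comment> \<open>Some budget is at most the average. The bound on \<open>N\<close> keeps it
    within \<open>M\<close>, so the guarantee applies to the stream of that expert.\<close>
  have "\<exists>i<n. n * e i \<le> N * Suc S"
  proof (rule ccontr)
    assume "\<not> ?thesis"
    then have "(\<Sum>i<n. N * Suc S) < (\<Sum>i<n. n * e i)"
      using \<open>n > 0\<close> by (intro sum_strict_mono) (auto simp: not_le)
    then have "n * (N * Suc S) < n * (\<Sum>i<n. e i)" by (simp add: sum_distrib_left)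
    with e show False by simp
  qed
  then obtain i where i: "i < n" "n * e i \<le> N * Suc S" by blast
  obtain xs where xs: "xs \<in> day_streams n N" "alg_mistakes A xs = N" "expert_mistakes xs i \<le> e i"
    using path[OF i(1)] by blast
  have "n * e i \<le> M * n" using i(2) N unfolding S_def by (rule le_trans)
  then have "e i \<le> M" using \<open>n > 0\<close> by (simp add: mult.commute)
  then have "expert_mistakes xs i \<le> M" using xs(3) by simp
  from mistakes_le_regret[OF ach xs(1) \<open>N \<le> T\<close> i(1) this] xs(2,3)
  have "real N \<le> real (e i) + R * real T" by simp
  moreover have "real (e i) \<le> real N * real (Suc S) / real n"
    using i(2) \<open>n > 0\<close> by (simp add: field_simps flip: of_nat_mult of_nat_Suc of_nat_add)
  ultimately show ?thesis unfolding S_def by linarith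
qed

section \<open>Bounds for the remaining parameter ranges\<close>

lemma two_experts_regret:
  fixes A :: "'a::finite expert_alg" and x y :: 'a
  assumes "x \<noteq> y" and ach: "achieves_regret A n T M R" and "n \<ge> 2" and "M \<le> T"
  shows "real M \<le> 2 * (R * real T)"
proof -
  \<comment> \<open>The better of experts 0 and 1 errs on at most half of the days, hence at most
    \<open>M\<close> times within \<open>2 * M\<close> days.\<close>
  define N where "N = min T (2 * M)"
  let ?ps = "x # replicate (n - 1) y"
  have "\<exists>xs\<in>day_streams n k. alg_mistakes A xs = k
          \<and> expert_mistakes xs 0 + expert_mistakes xs 1 = k" for k
  proof (induction k)
    case (Suc k)
    then obtain xs where xs: "xs \<in> day_streams n k" "alg_mistakes A xs = k"
      "expert_mistakes xs 0 + expert_mistakes xs 1 = k" by blast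
    define z where "z = (if predict A (memory A xs) ?ps = x then y else x)"
    have "?ps ! 1 = y" using \<open>n \<ge> 2\<close> by simp
    then show ?case
      using xs \<open>x \<noteq> y\<close> \<open>n \<ge> 2\<close>
      by (intro bexI[of _ "xs @ [(?ps, z)]"] day_streams_snoc) (auto simp: z_def)
  qed simp
  then obtain xs where xs: "xs \<in> day_streams n N" "alg_mistakes A xs = N"
    "expert_mistakes xs 0 + expert_mistakes xs 1 = N" by blast
  then obtain i where i: "i < n" "2 * expert_mistakes xs i \<le> N"
    using \<open>n \<ge> 2\<close> that[of 0] that[of 1] by linarith
  have "N \<le> T" "expert_mistakes xs i \<le> M" using i(2) by (auto simp: N_def)
  from mistakes_le_regret[OF ach xs(1) this(1) i(1) this(2)] xs(2) i(2)
  have "real N \<le> 2 * (R * real T)" by linarith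
  moreover have "M \<le> N" using \<open>M \<le> T\<close> by (simp add: N_def)
  ultimately show ?thesis by linarith
qed

text \<open>With no memory, the prediction on a repeated vector of predictions never changes, so a
  fixed outcome contradicts it every day while some expert is always right. The result allows
  \<open>S + 1\<close> to be replaced by \<open>2 * S\<close> in the final bound.\<close>

lemma alg_space_pos:
  fixes A :: "'a::finite expert_alg" and x y :: 'a
  assumes "x \<noteq> y" and ach: "achieves_regret A n T M R" and "n \<ge> 2" and "T > 0" and "R < 1"
  shows "alg_space A n T M > 0"
proof (rule ccontr)
  assume "\<not> ?thesis"
  then have S: "alg_space A n T M = 0" by simp
  let ?ps = "x # replicate (n - 1) y"
  define z where "z = (if predict A [] ?ps = x then y else x)"
  \<comment> \<open>Expert 0 predicts \<open>x\<close> and expert 1 predicts \<open>y\<close>, so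
    one of them matches \<open>z\<close>.\<close>
  obtain i where i: "i < n" "?ps ! i = z"
    using \<open>n \<ge> 2\<close> that[of 0] that[of 1] by (fastforce simp: z_def split: if_splits)
  have "\<exists>xs\<in>day_streams n k. alg_mistakes A xs = k \<and> expert_mistakes xs i = 0"
    if "k \<le> T" for k
    using that
  proof (induction k)
    case (Suc k)
    then obtain xs where xs: "xs \<in> day_streams n k" "alg_mistakes A xs = k"
      "expert_mistakes xs i = 0" by auto
    have "memory A xs = []"
      using prefix_memory_le_space[OF xs(1) _ i(1), of T M A] xs(3) Suc.prems S by simp
    then show ?case
      using xs i \<open>x \<noteq> y\<close> \<open>n \<ge> 2\<close>
      by (intro bexI[of _ "xs @ [(?ps, z)]"] day_streams_snoc) (auto simp: z_def)
  qed simp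
  then obtain xs where xs: "xs \<in> day_streams n T" "alg_mistakes A xs = T"
    "expert_mistakes xs i = 0" by blast
  from mistakes_le_regret[OF ach xs(1) order.refl i(1)] xs(2,3) have "real T \<le> R * real T" by simp
  with \<open>T > 0\<close> \<open>R < 1\<close> show False by simp
qed

section \<open>Combining the bounds\<close>

lemma space_lower_bound:
  fixes A :: "'a::finite expert_alg" and x y :: 'a
  assumes "x \<noteq> y" and ach: "achieves_regret A n T M R"
    and "n \<ge> 2" "T > 0" "M \<le> T" "0 < R" "R \<le> \<rho>" "\<rho> < 1"
  shows "min (1 - \<rho>) (1 / 2) / 4 * (real n * real M / (R * real T)) \<le> real (alg_space A n T M)"
proof -
  define S where "S = alg_space A n T M"
  define s where "s = real (Suc S)"
  define K where "K = R * real T"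
  \<comment> \<open>The part \<open>1 - \<rho>\<close> rules out a path through all \<open>T\<close>
    days; the part \<open>1 / 2\<close> makes the average budget less than half of the days.\<close>
  define \<delta> where "\<delta> = min (1 - \<rho>) (1 / 2)"
  have K: "K > 0" using assms by (simp add: K_def)
  have \<delta>: "0 < \<delta>" "\<delta> \<le> 1 / 2" "\<delta> \<le> 1 - \<rho>" using \<open>\<rho> < 1\<close> unfolding \<delta>_def by linarith+
  have MK: "real M \<le> 2 * K" using two_experts_regret[OF assms(1-3) \<open>M \<le> T\<close>] by (simp add: K_def)
  have "S > 0" using alg_space_pos[OF assms(1-4)] assms(7,8) by (simp add: S_def)
  then have sS: "s \<le> 2 * real S" by (simp add: s_def)
  have "s > 0" by (simp add: s_def)
  have n: "real n > 0" using \<open>n \<ge> 2\<close> by simp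
  have "\<delta> * (real n * real M) \<le> 2 * K * s"
  proof (cases "\<delta> * real n \<le> s")
    case True
    then have "\<delta> * real n * real M \<le> s * (2 * K)"
      using MK \<open>s > 0\<close> by (intro mult_mono) auto
    then show ?thesis by (simp add: mult_ac)
  next
    case False
    have half: "2 * s < real n"
      using False mult_right_mono[OF \<delta>(2), of "real n"] by simp
    show ?thesis
    proof (cases "T * Suc S \<le> M * n")
      case True
      have "real T \<le> real T * s / real n + R * real T"
        using path_regret[OF assms(1,2) _ order.refl] \<open>n \<ge> 2\<close> True by (simp add: S_def s_def)
      then have "real T * 1 \<le> real T * (s / real n + R)" by (simp add: algebra_simps)
      then have "1 \<le> s / real n + R" using \<open>T > 0\<close> by simp
      \<comment> \<open>This contradicts \<open>s < \<delta> * n\<close>, the case at hand.\<close>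
      then have "\<delta> \<le> s / real n" using \<open>R \<le> \<rho>\<close> \<delta> by linarith
      with False n show ?thesis by (simp add: field_simps)
    next
      case *: False
      \<comment> \<open>The longest path that the budget \<open>M * n\<close> allows; it is shorter
        than the stream in this case.\<close>
      define N where "N = M * n div Suc S"
      have NM: "N * Suc S \<le> M * n" by (simp add: N_def div_times_less_eq_dividend del: mult_Suc_right)
      have "N * Suc S \<le> T * Suc S" using NM * by linarith
      then have "N \<le> T" by (simp del: mult_Suc_right)
      then have "real N \<le> real N * s / real n + K"
        using path_regret[OF assms(1,2)] \<open>n \<ge> 2\<close> NM by (simp add: S_def s_def K_def)
      also have "real N * s / real n \<le> real N / 2"
        using mult_left_mono[of "2 * s" "real n" "real N"] half n by (simp add: field_simps)
      finally have NK: "real N \<le> 2 * K" by simp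
      have "M * n < Suc N * Suc S"
        unfolding N_def using dividend_less_div_times[of "Suc S" "M * n"] by simp
      then have "real (M * n) < real (Suc N * Suc S)" by (simp only: of_nat_less_iff)
      then have lt: "real M * real n < (real N + 1) * s"
        unfolding of_nat_mult s_def by (simp add: add.commute)
      show ?thesis
      proof (cases "M = 0")
        case True
        then show ?thesis using K \<open>s > 0\<close> by simp
      next
        case False
        \<comment> \<open>For positive \<open>M\<close>, the bound \<open>2 * s < n\<close> gives
          \<open>N > 1\<close>, so the rounding in \<open>N\<close> costs at most a factor 2, as
          \<open>N + 1 \<le> 2 * N\<close>.\<close>
        then have "1 * real n \<le> real M * real n" by (intro mult_right_mono) auto
        with half lt have "2 * s < (real N + 1) * s" by linarith
        with \<open>s > 0\<close> have "real N > 1" by simp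
        then have "(real N + 1) * s \<le> 2 * real N * s" using \<open>s > 0\<close> by simp
        also have "\<dots> \<le> 2 * (2 * K) * s" using NK \<open>s > 0\<close> by simp
        finally have "real M * real n \<le> 4 * K * s" using lt by simp
        then have "\<delta> * (real n * real M) \<le> (1 / 2) * (4 * K * s)"
          using mult_mono[OF \<delta>(2), of "real n * real M" "4 * K * s"]
          by (simp add: mult.commute[of "real n"])
        then show ?thesis by simp
      qed
    qed
  qed
  also have "\<dots> \<le> 2 * K * (2 * real S)" using K sS by (intro mult_left_mono) auto
  finally have "\<delta> / 4 * (real n * real M / K) \<le> real S" using K by (simp add: field_simps)
  then show ?thesis by (simp only: \<delta>_def K_def S_def)
qed

theorem theorem1p1:
  fixes \<rho> :: real
  assumes "card (UNIV :: 'a::finite set) \<ge> 2" and "\<rho> < 1"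
  shows "\<exists>c>0. \<forall>(n :: nat \<Rightarrow> nat) (M :: nat \<Rightarrow> nat) (R :: nat \<Rightarrow> real) (A :: nat \<Rightarrow> 'a expert_alg).
    (\<lambda>T. real (n T)) \<in> o(\<lambda>T. 2 ^ T) \<longrightarrow>
    (\<forall>\<^sub>F T in sequentially.
       n T \<ge> 2 \<and> M T \<le> T \<and> 0 < R T \<and> R T \<le> \<rho> \<and>
       achieves_regret (A T) (n T) T (M T) (R T)) \<longrightarrow>
    (\<forall>\<^sub>F T in sequentially.
       real (alg_space (A T) (n T) T (M T)) \<ge> c * (real (n T) * real (M T) / (R T * real T)))"
proof -
  obtain x y :: 'a where "x \<noteq> y"
  proof -
    have "\<not> card (UNIV :: 'a set) \<le> Suc 0" using assms(1) by linarith
    then show ?thesis using that card_le_Suc0_iff_eq[of "UNIV :: 'a set"] by auto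
  qed
  \<comment> \<open>The divisor 4 combines the 2 in \<open>2 * K * s\<close> with the 2 in
    \<open>s \<le> 2 * S\<close>.\<close>
  define c where "c = min (1 - \<rho>) (1 / 2) / 4"
  have "c > 0" using assms(2) by (simp add: c_def)
  show ?thesis
  proof (intro exI[of _ c] conjI allI impI \<open>c > 0\<close>)
    fix n M :: "nat \<Rightarrow> nat" and R :: "nat \<Rightarrow> real" and A :: "nat \<Rightarrow> 'a expert_alg"
    assume "\<forall>\<^sub>F T in sequentially. n T \<ge> 2 \<and> M T \<le> T \<and> 0 < R T \<and> R T \<le> \<rho> \<and>
       achieves_regret (A T) (n T) T (M T) (R T)"
    then show "\<forall>\<^sub>F T in sequentially.
       real (alg_space (A T) (n T) T (M T)) \<ge> c * (real (n T) * real (M T) / (R T * real T))"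
      using eventually_gt_at_top[of "0::nat"]
    proof eventually_elim
      case (elim T)
      then show ?case
        unfolding c_def using assms(2) by (intro space_lower_bound[OF \<open>x \<noteq> y\<close>]) auto
    qed
  qed
qed

end
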